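(* Let $L$ be a finite-dimensional restricted Lie algebra over an algebraically closed field $F$ of characteristic $p>0$, and let $U$ be a proper subalgebra of $L$. Then the following are equivalent: (i) $U$ is modular in $L$; (ii) $U$ is semi-modular in $L$; (iii) $U$ is a quasi-ideal of $L$.
   Context: For subalgebras $U,B$ of a Lie algebra $L$, $\langle U,B\rangle$ denotes the subalgebra generated by $U\cup B$. A subalgebra $B$ covers a subalgebra $A$ if $A$ is a maximal subalgebra of $B$. $U$ is modular in $L$ if $\langle U,B\rangle\cap C=\langle B,U\cap C\rangle$ for all subalgebras $B\subseteq C$ of $L$, and $\langle U,B\rangle\cap C=\langle B\cap C,U\rangle$ for all subalgebras $B,C$ of $L$ with $U\subseteq C$. $U$ is upper modular (um) in $L$ if whenever $B$ is a subalgebra of $L$ which covers $U\cap B$, then $\langle U,B\rangle$ covers $U$; $U$ is lower modular (lm) in $L$ if whenever $B$ is a subalgebra of $L$ such that $\langle U,B\rangle$ covers $U$, then $B$ covers $U\cap B$; $U$ is semi-modular (sm) in $L$ if it is both um and lm. A subalgebra $Q$ is a quasi-ideal of $L$ if $[Q,V]\subseteq Q+V$ for every subspace $V$ of $L$. *)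

theory Defs
  imports Main "HOL-Computational_Algebra.Polynomial"
begin

definition alg_closed_field :: "'f::field itself \<Rightarrow> bool" where
  "alg_closed_field _ \<longleftrightarrow> (\<forall>q :: 'f poly. 0 < degree q \<longrightarrow> (\<exists>x. poly q x = 0))"

definition lie_algebra :: "('f::field \<Rightarrow> 'v::ab_group_add \<Rightarrow> 'v) \<Rightarrow> ('v \<Rightarrow> 'v \<Rightarrow> 'v) \<Rightarrow> bool" where
  "lie_algebra sc br \<longleftrightarrow> vector_space sc
     \<and> (\<forall>x y z. br (x + y) z = br x z + br y z)
     \<and> (\<forall>x y z. br x (y + z) = br x y + br x z)
     \<and> (\<forall>a x y. br (sc a x) y = sc a (br x y))
     \<and> (\<forall>a x y. br x (sc a y) = sc a (br x y))
     \<and> (\<forall>x. br x x = 0)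
     \<and> (\<forall>x y z. br x (br y z) + br y (br z x) + br z (br x y) = 0)"

definition fin_dim :: "('f::field \<Rightarrow> 'v::ab_group_add \<Rightarrow> 'v) \<Rightarrow> bool" where
  "fin_dim sc \<longleftrightarrow> (\<exists>B. finite B \<and> module.span sc B = UNIV)"

text \<open>Jacobson's s_i: i * s_i(x,y) is the coefficient of t^(i-1) in ad(tx+y)^(p-1)(x).
  Expanding ad(tx+y)^(p-1) as a sum over words in {ad x, ad y} of length p-1, this coefficient
  is the sum over words with exactly i-1 letters ad x.\<close>
definition ad_word :: "('v \<Rightarrow> 'v \<Rightarrow> 'v) \<Rightarrow> 'v \<Rightarrow> 'v \<Rightarrow> bool list \<Rightarrow> 'v \<Rightarrow> 'v" where
  "ad_word br x y ws = foldr (\<lambda>b f. (\<lambda>v. br (if b then x else y) (f v))) ws id"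

definition jacobson_s :: "('f::field \<Rightarrow> 'v::ab_group_add \<Rightarrow> 'v) \<Rightarrow> ('v \<Rightarrow> 'v \<Rightarrow> 'v) \<Rightarrow> nat \<Rightarrow> nat \<Rightarrow> 'v \<Rightarrow> 'v \<Rightarrow> 'v" where
  "jacobson_s sc br p i x y = sc (inverse (of_nat i))
     (\<Sum>ws\<in>{ws. length ws = p - 1 \<and> length (filter id ws) = i - 1}. ad_word br x y ws x)"

definition restricted_lie_algebra ::
  "('f::field \<Rightarrow> 'v::ab_group_add \<Rightarrow> 'v) \<Rightarrow> ('v \<Rightarrow> 'v \<Rightarrow> 'v) \<Rightarrow> nat \<Rightarrow> ('v \<Rightarrow> 'v) \<Rightarrow> bool" where
  "restricted_lie_algebra sc br p pm \<longleftrightarrow> lie_algebra sc br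
     \<and> (\<forall>a x. pm (sc a x) = sc (a ^ p) (pm x))
     \<and> (\<forall>x y. br (pm x) y = ((\<lambda>v. br x v) ^^ p) y)
     \<and> (\<forall>x y. pm (x + y) = pm x + pm y + (\<Sum>i\<in>{1..p-1}. jacobson_s sc br p i x y))"

definition subalgebra :: "('f::field \<Rightarrow> 'v::ab_group_add \<Rightarrow> 'v) \<Rightarrow> ('v \<Rightarrow> 'v \<Rightarrow> 'v) \<Rightarrow> 'v set \<Rightarrow> bool" where
  "subalgebra sc br S \<longleftrightarrow> module.subspace sc S \<and> (\<forall>x\<in>S. \<forall>y\<in>S. br x y \<in> S)"

definition gen_sub :: "('f::field \<Rightarrow> 'v::ab_group_add \<Rightarrow> 'v) \<Rightarrow> ('v \<Rightarrow> 'v \<Rightarrow> 'v) \<Rightarrow> 'v set \<Rightarrow> 'v set \<Rightarrow> 'v set" where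
  "gen_sub sc br U B = \<Inter>{S. subalgebra sc br S \<and> U \<union> B \<subseteq> S}"

definition covers :: "('f::field \<Rightarrow> 'v::ab_group_add \<Rightarrow> 'v) \<Rightarrow> ('v \<Rightarrow> 'v \<Rightarrow> 'v) \<Rightarrow> 'v set \<Rightarrow> 'v set \<Rightarrow> bool" where
  "covers sc br B A \<longleftrightarrow> subalgebra sc br A \<and> subalgebra sc br B \<and> A \<subset> B
     \<and> (\<forall>C. subalgebra sc br C \<and> A \<subseteq> C \<and> C \<subseteq> B \<longrightarrow> C = A \<or> C = B)"

definition modular :: "('f::field \<Rightarrow> 'v::ab_group_add \<Rightarrow> 'v) \<Rightarrow> ('v \<Rightarrow> 'v \<Rightarrow> 'v) \<Rightarrow> 'v set \<Rightarrow> bool" where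
  "modular sc br U \<longleftrightarrow>
     (\<forall>B C. subalgebra sc br B \<and> subalgebra sc br C \<and> B \<subseteq> C \<longrightarrow>
        gen_sub sc br U B \<inter> C = gen_sub sc br B (U \<inter> C))
   \<and> (\<forall>B C. subalgebra sc br B \<and> subalgebra sc br C \<and> U \<subseteq> C \<longrightarrow>
        gen_sub sc br U B \<inter> C = gen_sub sc br (B \<inter> C) U)"

definition upper_modular :: "('f::field \<Rightarrow> 'v::ab_group_add \<Rightarrow> 'v) \<Rightarrow> ('v \<Rightarrow> 'v \<Rightarrow> 'v) \<Rightarrow> 'v set \<Rightarrow> bool" where
  "upper_modular sc br U \<longleftrightarrow> (\<forall>B. subalgebra sc br B \<and> covers sc br B (U \<inter> B) \<longrightarrow>
       covers sc br (gen_sub sc br U B) U)"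

definition lower_modular :: "('f::field \<Rightarrow> 'v::ab_group_add \<Rightarrow> 'v) \<Rightarrow> ('v \<Rightarrow> 'v \<Rightarrow> 'v) \<Rightarrow> 'v set \<Rightarrow> bool" where
  "lower_modular sc br U \<longleftrightarrow> (\<forall>B. subalgebra sc br B \<and> covers sc br (gen_sub sc br U B) U \<longrightarrow>
       covers sc br B (U \<inter> B))"

definition semi_modular :: "('f::field \<Rightarrow> 'v::ab_group_add \<Rightarrow> 'v) \<Rightarrow> ('v \<Rightarrow> 'v \<Rightarrow> 'v) \<Rightarrow> 'v set \<Rightarrow> bool" where
  "semi_modular sc br U \<longleftrightarrow> upper_modular sc br U \<and> lower_modular sc br U"

definition quasi_ideal :: "('f::field \<Rightarrow> 'v::ab_group_add \<Rightarrow> 'v) \<Rightarrow> ('v \<Rightarrow> 'v \<Rightarrow> 'v) \<Rightarrow> 'v set \<Rightarrow> bool" where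
  "quasi_ideal sc br Q \<longleftrightarrow> subalgebra sc br Q \<and>
     (\<forall>V. module.subspace sc V \<longrightarrow>
        module.span sc {br q v | q v. q \<in> Q \<and> v \<in> V} \<subseteq> {q + v | q v. q \<in> Q \<and> v \<in> V})"

end

theory Submission
  imports Defs "HOL-Computational_Algebra.Primes"
begin

text \<open>
  Only semi-modular implies quasi-ideal needs restrictedness. For every \<open>y\<close> some iterate \<open>s\<close> of the \<open>p\<close>-map at \<open>y\<close> is
  ad-diagonalizable, because \<open>(ad y - c)\<close> to the power \<open>p\<^sup>n\<close> equals \<open>(ad y)\<close> to the power \<open>p\<^sup>n\<close>
  minus a scalar. Semi-modularity gives \<open>\<langle>U, s\<rangle> = U + Fs\<close> for ad-diagonalizable \<open>s \<notin> U\<close>. Let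
  \<open>x \<notin> U\<close>, so that \<open>M = \<langle>U, x\<rangle>\<close> covers \<open>U\<close>, and suppose that \<open>M \<noteq> U + Fx\<close>. Then \<open>U\<close> is its own
  normalizer in \<open>M\<close>, and every ad-diagonalizable \<open>p\<close>-power of an element normalizing \<open>M\<close>
  normalizes \<open>U\<close>. For \<open>u \<in> U\<close> with ad-diagonalizable \<open>p\<close>-power \<open>s\<close>, this puts the eigenvectors of
  \<open>ad s\<close> in \<open>M\<close> with nonzero eigenvalue into \<open>U\<close>, so \<open>ad u\<close> is nilpotent on \<open>M/U\<close>. By Engel's theorem \<open>U\<close>
  then has a larger normalizer in \<open>M\<close>, a contradiction.
\<close>

section \<open>Diagonalizable Frobenius powers\<close>

text \<open>The action of the \<open>F[t]\<close>-module in which \<open>t\<close> acts as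
  \<open>T\<close>. \<open>T\<close> is a bare function, so that linearity enters only from products
  of polynomials onwards.\<close>

definition poly_act :: "('f::field \<Rightarrow> 'v::ab_group_add \<Rightarrow> 'v) \<Rightarrow> 'f poly \<Rightarrow> ('v \<Rightarrow> 'v) \<Rightarrow> 'v \<Rightarrow> 'v" where
  "poly_act sc q T v = (\<Sum>i\<le>degree q. sc (coeff q i) ((T ^^ i) v))"

text \<open>Split off one root at a time; no multiplicity exceeds the degree. One common exponent
  over a set of distinct roots is the right form here: for \<open>m\<close> a power of the
  characteristic each factor becomes \<open>t^m - c\<close>.\<close>

lemma alg_closed_dvd_linear_powers:
  fixes q :: "'f::field poly"
  assumes "alg_closed_field TYPE('f)" and "q \<noteq> 0" and "degree q \<le> m"
  shows "\<exists>A. finite A \<and> q dvd (\<Prod>a\<in>A. [:- a, 1:]) ^ m"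
  using assms(2,3)
proof (induction m arbitrary: q)
  case 0
  then have "q dvd 1"
    by (metis degree_eq_zeroE is_unit_triv le_zero_eq pCons_eq_0_iff)
  then show ?case by (intro exI[of _ "{}"]) simp
next
  case (Suc m)
  show ?case
  proof (cases "degree q = 0")
    case True
    then have "q dvd 1"
      using Suc.prems(1) by (metis degree_eq_zeroE is_unit_triv pCons_eq_0_iff)
    then show ?thesis by (intro exI[of _ "{}"]) simp
  next
    case False
    then obtain a where "poly q a = 0"
      using assms(1) unfolding alg_closed_field_def by blast
    then obtain r where r: "q = [:- a, 1:] * r"
      by (auto simp: poly_eq_0_iff_dvd elim: dvdE)
    then have "r \<noteq> 0" using Suc.prems(1) by auto
    then have "degree q = Suc (degree r)"
      unfolding r by (subst degree_mult_eq) auto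
    then obtain A where A: "finite A" "r dvd (\<Prod>a\<in>A. [:- a, 1:]) ^ m"
      using Suc.IH[OF \<open>r \<noteq> 0\<close>] Suc.prems(2) by auto
    let ?P = "\<Prod>a\<in>insert a A. [:- a, 1:]"
    have "(\<Prod>a\<in>A. [:- a, 1:]) dvd ?P"
      using A(1) by (intro prod_dvd_prod_subset) auto
    then have "r dvd ?P ^ m"
      using A(2) by (meson dvd_power_same dvd_trans)
    moreover have "[:- a, 1:] dvd ?P"
      using A(1) by (intro dvd_prodI) auto
    \<comment> \<open>If \<open>a\<close> lies in \<open>A\<close> already, the base stays the same,
      and the additional factor \<open>?P\<close> absorbs the repeated root.\<close>
    ultimately have "q dvd ?P * ?P ^ m"
      unfolding r by (rule mult_dvd_mono[rotated])
    then show ?thesis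
      using A(1) by (intro exI[of _ "insert a A"]) simp
  qed
qed

section \<open>Polynomials acting through an operator\<close>

context vector_space
begin

lemma poly_act_upto:
  fixes q :: "'a poly"
  assumes "degree q \<le> n"
  shows "poly_act scale q T v = (\<Sum>i\<le>n. scale (coeff q i) ((T ^^ i) v))"
  unfolding poly_act_def using assms
  by (intro sum.mono_neutral_left) (auto simp: coeff_eq_0)

lemma poly_act_0 [simp]: "poly_act scale 0 T v = 0"
  by (simp add: poly_act_def)

lemma poly_act_1 [simp]: "poly_act scale 1 T v = v"
  by (simp add: poly_act_def)

lemma poly_act_add: "poly_act scale (q + r) T v = poly_act scale q T v + poly_act scale r T v"
proof -
  let ?n = "max (degree q) (degree r)"
  have "degree (q + r) \<le> ?n" by (rule degree_add_le_max)
  then show ?thesis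
    by (simp add: poly_act_upto[of _ ?n] scale_left_distrib sum.distrib)
qed

lemma poly_act_smult: "poly_act scale (smult c q) T v = scale c (poly_act scale q T v)"
  by (simp add: poly_act_upto[of _ "degree q"] degree_smult_le scale_sum_right)

lemma poly_act_diff: "poly_act scale (q - r) T v = poly_act scale q T v - poly_act scale r T v"
  using poly_act_add[of "q - r" r T v] by simp

lemma poly_act_pCons: "poly_act scale (pCons a q) T v = scale a v + poly_act scale q T (T v)"
proof -
  have "poly_act scale (pCons a q) T v
      = (\<Sum>i\<le>Suc (degree q). scale (coeff (pCons a q) i) ((T ^^ i) v))"
    by (rule poly_act_upto) (rule degree_pCons_le)
  also have "\<dots> = scale a v + poly_act scale q T (T v)"
    unfolding poly_act_def sum.atMost_Suc_shift by (simp add: funpow_swap1)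
  finally show ?thesis .
qed

lemma poly_act_monom: "poly_act scale (monom c n) T v = scale c ((T ^^ n) v)"
  by (induction n arbitrary: v)
     (simp_all add: monom_0 monom_Suc poly_act_pCons funpow_swap1)

lemma poly_act_const: "poly_act scale [:c:] T v = scale c v"
  by (simp add: poly_act_pCons)

context
  fixes T :: "'b \<Rightarrow> 'b"
  assumes T_add: "\<And>x y. T (x + y) = T x + T y"
    and T_scale: "\<And>c x. T (scale c x) = scale c (T x)"
begin

lemma T_zero: "T 0 = 0"
  using T_add[of 0 0] by simp

lemma poly_act_commute: "poly_act scale q T (T v) = T (poly_act scale q T v)"
  by (induction q arbitrary: v) (auto simp: T_zero poly_act_pCons T_add T_scale)

lemma poly_act_mult: "poly_act scale (q * r) T v = poly_act scale q T (poly_act scale r T v)"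
  by (induction q arbitrary: v)
     (auto simp: poly_act_pCons poly_act_add poly_act_smult poly_act_commute)

lemma poly_act_vec_zero: "poly_act scale q T 0 = 0"
  by (induction q) (auto simp: poly_act_pCons T_zero)

lemma funpow_T_add: "(T ^^ n) (x + y) = (T ^^ n) x + (T ^^ n) y"
  by (induction n) (auto simp: T_add)

lemma funpow_T_scale: "(T ^^ n) (scale c x) = scale c ((T ^^ n) x)"
  by (induction n) (auto simp: T_scale)

lemma funpow_T_diff: "(T ^^ n) (x - y) = (T ^^ n) x - (T ^^ n) y"
  using funpow_T_add[of n "x - y" y] by (simp add: algebra_simps)

lemma eigenvectors_span_of_annihilated:
  assumes "finite C" and "subspace W" and "(T ^^ m) ` W \<subseteq> W" and "v \<in> W"
    and "poly_act scale (\<Prod>c\<in>C. monom 1 m - [:c:]) T v = 0"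
  shows "v \<in> span {w \<in> W. \<exists>c\<in>C. (T ^^ m) w = scale c w}"
  using assms(1,4,5)
proof (induction C arbitrary: v)
  case empty
  then show ?case by (simp add: span_zero)
next
  case (insert d C)
  have Tm: "(T ^^ m) w \<in> W" if "w \<in> W" for w
    using that assms(3) by blast
  let ?E = "\<lambda>C. {w \<in> W. \<exists>c\<in>C. (T ^^ m) w = scale c w}"
  define u where "u = (T ^^ m) v - scale d v"
  have uW: "u \<in> W"
    unfolding u_def using assms(2) Tm insert.prems(1) by (intro subspace_diff subspace_scale) auto
  have "poly_act scale ((\<Prod>c\<in>C. monom 1 m - [:c:]) * (monom 1 m - [:d:])) T v = 0"
    using insert by (simp add: mult.commute)
  then have "poly_act scale (\<Prod>c\<in>C. monom 1 m - [:c:]) T u = 0"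
    by (simp add: poly_act_mult poly_act_diff poly_act_monom poly_act_const u_def)
  then have "u \<in> span (?E C)"
    using insert.IH uW by blast
  then have "\<exists>z\<in>span (?E C). (T ^^ m) z - scale d z = u"
  proof (induction rule: span_induct_alt)
    case base
    show ?case by (intro bexI[of _ 0]) (auto simp: span_zero funpow_T_diff[of m 0 0, simplified])
  next
    case (step a w y)
    then obtain z c where z: "z \<in> span (?E C)" "(T ^^ m) z - scale d z = y"
      and c: "c \<in> C" "(T ^^ m) w = scale c w" by auto
    have "c \<noteq> d" using c insert.hyps by auto
    \<comment> \<open>On \<open>w\<close> the operator \<open>T^m - d\<close> is multiplication by
      \<open>c - d\<close>, whence the denominator.\<close>
    let ?z = "scale (a / (c - d)) w + z"
    have "?z \<in> span (?E C)"
      using z(1) step(1) by (intro span_add[OF span_scale[OF span_base]])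
    moreover have "(T ^^ m) ?z - scale d ?z
        = scale (a / (c - d) * c - a / (c - d) * d) w + ((T ^^ m) z - scale d z)"
      by (simp add: funpow_T_add funpow_T_scale c scale_left_diff_distrib scale_right_distrib algebra_simps)
    moreover have "a / (c - d) * c - a / (c - d) * d = a"
      using \<open>c \<noteq> d\<close> by (subst right_diff_distrib[symmetric]) simp
    ultimately show ?case using z(2) by (intro bexI[of _ ?z]) auto
  qed
  then obtain z where z: "z \<in> span (?E C)" "(T ^^ m) z - scale d z = u" by blast
  have sub: "?E C \<subseteq> ?E (insert d C)" by auto
  have "span (?E C) \<subseteq> W"
    using assms(2) by (intro span_minimal) auto
  then have "v - z \<in> W"
    using insert.prems(1) z(1) assms(2) subspace_diff by blast
  moreover have "(T ^^ m) (v - z) = scale d (v - z)"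
    using z(2) by (simp add: funpow_T_diff scale_right_diff_distrib u_def algebra_simps)
  ultimately have "v - z \<in> span (?E (insert d C))"
    by (intro span_base) auto
  moreover have "z \<in> span (?E (insert d C))"
    using z(1) span_mono[OF sub] by blast
  ultimately show ?case
    using span_add by fastforce
qed

end

end

section \<open>Annihilating polynomials in finite dimension\<close>

context finite_dimensional_vector_space
begin

text \<open>One more iterate of \<open>v\<close> than the dimension: either these vectors are
  distinct and linearly dependent, or two of them coincide and \<open>t^j - t^i\<close> works. The
  repetition is a case of its own because dependence is a property of the set of iterates.\<close>

lemma ex_annihilating_poly: "\<exists>q. q \<noteq> 0 \<and> degree q \<le> dimension \<and> poly_act scale q T v = 0"
proof (cases "inj_on (\<lambda>i. (T ^^ i) v) {..dimension}")
  case True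
  let ?S = "(\<lambda>i. (T ^^ i) v) ` {..dimension}"
  have "card ?S = Suc dimension" using True by (simp add: card_image)
  then have "dependent ?S"
    using independent_span_bound[OF finite_Basis, of ?S] by (auto simp: span_Basis dimension_def)
  then obtain u where u: "\<exists>w\<in>?S. u w \<noteq> 0" "(\<Sum>w\<in>?S. scale (u w) w) = 0"
    by (auto simp: dependent_finite)
  define q where "q = (\<Sum>i\<le>dimension. monom (u ((T ^^ i) v)) i)"
  have c: "coeff q k = (if k \<le> dimension then u ((T ^^ k) v) else 0)" for k
    by (simp add: q_def coeff_sum)
  have "q \<noteq> 0" using u(1) c by (auto simp: poly_eq_iff)
  moreover have "degree q \<le> dimension" by (rule degree_le) (simp add: c)
  moreover have "poly_act scale q T v = 0"
    using u(2) True \<open>degree q \<le> dimension\<close> by (simp add: poly_act_upto c sum.reindex)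
  ultimately show ?thesis by blast
next
  case False
  then obtain i j where ij: "i < j" "j \<le> dimension" "(T ^^ i) v = (T ^^ j) v"
    unfolding inj_on_def by (metis atMost_iff linorder_neqE_nat)
  let ?q = "monom 1 j - monom 1 i :: 'a poly"
  have "coeff ?q j = 1" using ij by simp
  then have "?q \<noteq> 0" by (metis coeff_0 zero_neq_one)
  moreover have "degree ?q \<le> dimension"
    using ij by (intro degree_diff_le order.trans[OF degree_monom_le]) auto
  moreover have "poly_act scale ?q T v = 0"
    using ij by (simp add: poly_act_diff poly_act_monom)
  ultimately show ?thesis by blast
qed

text \<open>With \<open>m\<close> a power of the characteristic,
  \<open>(t - a)^m = t^m - a^m\<close>, and \<open>a \<mapsto> a^m\<close> is injective. Hence a
  polynomial killing \<open>v\<close> divides a product of distinct factors \<open>t^m - c\<close>.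
  The exponent depends on the dimension only, so it serves all \<open>W\<close> and \<open>v\<close>
  at once.\<close>

lemma frobenius_power_diagonalizable:
  assumes "alg_closed_field TYPE('a)" and "prime CHAR('a)"
    and T_add: "\<And>x y. T (x + y) = T x + T y"
    and T_scale: "\<And>c x. T (scale c x) = scale c (T x)"
  shows "\<exists>N. \<forall>W v. subspace W \<longrightarrow> (T ^^ (CHAR('a) ^ N)) ` W \<subseteq> W \<longrightarrow> v \<in> W \<longrightarrow>
    v \<in> span {w \<in> W. \<exists>c. (T ^^ (CHAR('a) ^ N)) w = scale c w}"
proof (intro exI allI impI)
  let ?m = "CHAR('a) ^ dimension"
  fix W v assume W: "subspace W" "(T ^^ ?m) ` W \<subseteq> W" and v: "v \<in> W"
  \<comment> \<open>This makes \<open>?m\<close> an upper bound for all root multiplicities of an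
    annihilating polynomial.\<close>
  have "dimension \<le> ?m"
    using power_gt_expt[of "CHAR('a)" dimension] prime_gt_1_nat[OF assms(2)] by simp
  obtain q where q: "q \<noteq> 0" "degree q \<le> dimension" "poly_act scale q T v = 0"
    using ex_annihilating_poly by blast
  obtain A where A: "finite A" "q dvd (\<Prod>a\<in>A. [:- a, 1:]) ^ ?m"
    using alg_closed_dvd_linear_powers[OF assms(1) q(1)] q(2) \<open>dimension \<le> ?m\<close> by (meson le_trans)
  have inj: "inj_on (\<lambda>a. a ^ ?m) A"
  proof (rule inj_onI)
    fix a b :: 'a assume "a ^ ?m = b ^ ?m"
    then have "(a - b) ^ ?m = 0"
      using freshmans_dream'[OF assms(2) refl, where x = "a - b" and y = b and n = dimension] by simp
    then show "a = b" by simp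
  qed
  have lin: "[:- a, 1:] ^ ?m = monom 1 ?m - [:a ^ ?m:]" for a :: 'a
  proof -
    have "([:- a, 1:] + [:a:]) ^ ?m = [:- a, 1:] ^ ?m + [:a:] ^ ?m"
      using assms(2) by (intro freshmans_dream') (auto simp: semiring_char_poly)
    moreover have "([:- a, 1:] + [:a:]) ^ ?m = monom 1 ?m"
      by (simp add: monom_altdef)
    moreover have "[:a:] ^ ?m = [:a ^ ?m:]"
      by (rule poly_const_pow)
    ultimately show ?thesis by (simp add: eq_diff_eq)
  qed
  have "(\<Prod>a\<in>A. [:- a, 1:]) ^ ?m = (\<Prod>c\<in>(\<lambda>a. a ^ ?m) ` A. monom 1 ?m - [:c:])"
    by (simp add: prod_power_distrib lin prod.reindex[OF inj])
  moreover have "poly_act scale ((\<Prod>a\<in>A. [:- a, 1:]) ^ ?m) T v = 0"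
  proof -
    obtain r where "(\<Prod>a\<in>A. [:- a, 1:]) ^ ?m = r * q" using A(2) by (metis dvdE mult.commute)
    then show ?thesis
      by (simp add: poly_act_mult[OF T_add T_scale] q(3) poly_act_vec_zero[OF T_add T_scale])
  qed
  ultimately have "poly_act scale (\<Prod>c\<in>(\<lambda>a. a ^ ?m) ` A. monom 1 ?m - [:c:]) T v = 0"
    by simp
  note eigenvectors_span_of_annihilated[OF T_add T_scale finite_imageI[OF A(1)] W v this]
  then show "v \<in> span {w \<in> W. \<exists>c. (T ^^ ?m) w = scale c w}"
    by (rule set_mp[OF span_mono, rotated]) auto
qed

end

section \<open>Engel's theorem\<close>

locale lie_alg = vector_space sc for sc :: "'f::field \<Rightarrow> 'v::ab_group_add \<Rightarrow> 'v" +
  fixes br :: "'v \<Rightarrow> 'v \<Rightarrow> 'v"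
  assumes br_add_left: "br (x + y) z = br x z + br y z"
    and br_add_right: "br x (y + z) = br x y + br x z"
    and br_scale_left: "br (sc a x) y = sc a (br x y)"
    and br_scale_right: "br x (sc a y) = sc a (br x y)"
    and br_self: "br x x = 0"
    and jacobi: "br x (br y z) + br y (br z x) + br z (br x y) = 0"
begin

lemma br_zero_left [simp]: "br 0 x = 0"
  using br_add_left[of 0 0 x] by simp

lemma br_zero_right [simp]: "br x 0 = 0"
  using br_add_right[of x 0 0] by simp

lemma br_minus_left: "br (- x) y = - br x y"
  using br_add_left[of x "- x" y] by (simp add: eq_neg_iff_add_eq_0 add.commute)

lemma br_minus_right: "br x (- y) = - br x y"
  using br_add_right[of x y "- y"] by (simp add: eq_neg_iff_add_eq_0 add.commute)

lemma br_diff_left: "br (x - y) z = br x z - br y z"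
  using br_add_left[of x "- y" z] by (simp add: br_minus_left)

lemma br_diff_right: "br x (y - z) = br x y - br x z"
  using br_add_right[of x y "- z"] by (simp add: br_minus_right)

lemma br_swap: "br x y = - br y x"
proof -
  have "br (x + y) (x + y) = br x y + br y x"
    by (simp only: br_add_left br_add_right) (simp add: br_self)
  then show ?thesis by (simp add: br_self eq_neg_iff_add_eq_0)
qed

lemma br_br_left: "br (br x y) z = br x (br y z) - br y (br x z)"
proof -
  have "br (br x y) z = - br z (br x y)" by (rule br_swap)
  also have "\<dots> = br x (br y z) + br y (br z x)"
    using jacobi[of x y z] by (simp add: eq_neg_iff_add_eq_0 neg_eq_iff_add_eq_0 add.commute)
  also have "br y (br z x) = - br y (br x z)"
    using br_swap[of z x] by (simp add: br_minus_right)
  finally show ?thesis by simp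
qed

lemmas br_simps = br_add_left br_add_right br_scale_left br_scale_right br_self
  br_diff_left br_diff_right br_minus_left br_minus_right

lemma subalgebra_subspace: "subalgebra sc br S \<Longrightarrow> subspace S"
  by (simp add: subalgebra_def)

lemma subalgebra_br: "subalgebra sc br S \<Longrightarrow> x \<in> S \<Longrightarrow> y \<in> S \<Longrightarrow> br x y \<in> S"
  by (simp add: subalgebra_def)

lemma subalgebra_Int: "subalgebra sc br S \<Longrightarrow> subalgebra sc br S' \<Longrightarrow> subalgebra sc br (S \<inter> S')"
  by (auto simp: subalgebra_def intro: subspace_inter)

lemma subalgebra_gen_sub: "subalgebra sc br (gen_sub sc br X Y)"
  unfolding subalgebra_def gen_sub_def by (auto intro!: subspace_Inter)

lemma gen_sub_superset: "X \<union> Y \<subseteq> gen_sub sc br X Y"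
  unfolding gen_sub_def by blast

lemma gen_sub_least: "subalgebra sc br S \<Longrightarrow> X \<subseteq> S \<Longrightarrow> Y \<subseteq> S \<Longrightarrow> gen_sub sc br X Y \<subseteq> S"
  unfolding gen_sub_def by blast

lemma gen_sub_mono: "X \<subseteq> X' \<Longrightarrow> Y \<subseteq> Y' \<Longrightarrow> gen_sub sc br X Y \<subseteq> gen_sub sc br X' Y'"
  unfolding gen_sub_def by blast

lemma subalgebra_line: "subalgebra sc br (span {x})"
  unfolding subalgebra_def using subspace_span[of "{x}"]
  by (auto simp: span_singleton br_simps intro!: range_eqI[of _ _ 0])

lemma mem_adjoin: "subspace S \<Longrightarrow> y \<in> span (insert x S) \<longleftrightarrow> (\<exists>k. y - sc k x \<in> S)"
  by (simp add: span_breakdown_eq span_eq_iff[THEN iffD2])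

lemma adjoin_superset: "insert x S \<subseteq> span (insert x S)"
  by (rule span_superset)

text \<open>By bilinearity and \<open>br x x = 0\<close> only the brackets of \<open>S\<close> with
  \<open>x\<close> matter. They may have a component along \<open>x\<close>, as happens when
  \<open>x\<close> is an eigenvector.\<close>

lemma subalgebra_adjoin:
  assumes S: "subalgebra sc br S" and x: "\<And>u. u \<in> S \<Longrightarrow> br u x \<in> span (insert x S)"
  shows "subalgebra sc br (span (insert x S))"
  unfolding subalgebra_def
proof (intro conjI ballI)
  let ?A = "span (insert x S)"
  show "subspace ?A" by (rule subspace_span)
  have sub: "S \<subseteq> ?A" and xA: "x \<in> ?A" using span_superset by blast+
  fix y z assume "y \<in> ?A" "z \<in> ?A"
  then obtain j k where jk: "y - sc j x \<in> S" "z - sc k x \<in> S"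
    using mem_adjoin[OF subalgebra_subspace[OF S]] by blast
  define u w where "u = y - sc j x" and "w = z - sc k x"
  have uw: "u \<in> S" "w \<in> S" "y = u + sc j x" "z = w + sc k x"
    using jk by (auto simp: u_def w_def)
  have "br y z = br u w + sc k (br u x) - sc j (br w x)"
    using br_swap[of x w] by (simp add: uw(3,4) br_simps algebra_simps)
  moreover have "br u w \<in> ?A" using subalgebra_br[OF S uw(1,2)] sub by blast
  ultimately show "br y z \<in> ?A"
    using x[OF uw(1)] x[OF uw(2)] by (simp add: span_add span_diff span_scale)
qed

lemma ad_funpow_mem: "(\<And>w. w \<in> W \<Longrightarrow> br x w \<in> W) \<Longrightarrow> w \<in> W \<Longrightarrow> (br x ^^ n) w \<in> W"
  by (induction n) auto

lemma ad_nilpotent_on_operators: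
  assumes W': "subspace W'" "W' \<subseteq> W"
    and H: "subalgebra sc br H" "\<And>h w. h \<in> H \<Longrightarrow> w \<in> W \<Longrightarrow> br h w \<in> W"
      "\<And>h w. h \<in> H \<Longrightarrow> w \<in> W' \<Longrightarrow> br h w \<in> W'"
    and h: "h \<in> H" "\<And>w. w \<in> W \<Longrightarrow> (br h ^^ k) w \<in> W'"
    and u: "u \<in> H" and w: "w \<in> W"
  shows "2 * k \<le> a + b + j \<Longrightarrow> (br h ^^ a) (br ((br h ^^ j) u) ((br h ^^ b) w)) \<in> W'"
proof (induction j arbitrary: a b)
  \<comment> \<open>Leibniz: each further \<open>ad h\<close> applied to \<open>u\<close> moves to the left or to the right of \<open>u\<close>,
    so one of the two exponents finally reaches \<open>k\<close>.\<close>
  have big: "(br h ^^ n) v \<in> W'" if "k \<le> n" "v \<in> W" for n v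
  proof -
    have "(br h ^^ n) v = (br h ^^ (n - k)) ((br h ^^ k) v)"
      using that(1) funpow_add[of "n - k" k "br h"] by simp
    then show ?thesis
      using ad_funpow_mem[of W' h] H(3)[OF h(1)] h(2)[OF that(2)] by simp
  qed
  case 0
  have bW: "(br h ^^ b) w \<in> W" using ad_funpow_mem[of W h] H(2)[OF h(1)] w by simp
  show ?case
  proof (cases "k \<le> a")
    case True
    then show ?thesis using big H(2)[OF u bW] by simp
  next
    case False
    then have "(br h ^^ b) w \<in> W'" using 0 big w by simp
    then show ?thesis using ad_funpow_mem[of W' h] H(3) h(1) u by simp
  qed
next
  case (Suc j)
  have lin: "(br h ^^ a) (x - y) = (br h ^^ a) x - (br h ^^ a) y" for x y
    by (induction a) (auto simp: br_diff_right)
  have "(br h ^^ Suc a) (br ((br h ^^ j) u) ((br h ^^ b) w)) \<in> W'"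
    by (rule Suc.IH) (use Suc.prems in simp)
  then have "(br h ^^ a) (br h (br ((br h ^^ j) u) ((br h ^^ b) w))) \<in> W'"
    by (simp only: funpow_Suc_right comp_apply)
  moreover have "(br h ^^ a) (br ((br h ^^ j) u) ((br h ^^ Suc b) w)) \<in> W'"
    by (rule Suc.IH) (use Suc.prems in simp)
  ultimately show ?case
    using subspace_diff[OF W'(1)] by (simp add: br_br_left lin)
qed

end

section \<open>Common invariants of operators nilpotent on a quotient\<close>

locale fd_lie_alg = lie_alg sc br + finite_dimensional_vector_space sc Basis
  for sc :: "'f::field \<Rightarrow> 'v::ab_group_add \<Rightarrow> 'v" and br and Basis
begin

theorem engel:
  assumes "subalgebra sc br H" and "subspace W" and "subspace W'" and "W' \<subset> W"
    and "\<And>h w. h \<in> H \<Longrightarrow> w \<in> W \<Longrightarrow> br h w \<in> W"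
    and "\<And>h w. h \<in> H \<Longrightarrow> w \<in> W' \<Longrightarrow> br h w \<in> W'"
    and "\<And>h. h \<in> H \<Longrightarrow> \<exists>k. \<forall>w\<in>W. (br h ^^ k) w \<in> W'"
  shows "\<exists>v\<in>W - W'. \<forall>h\<in>H. br h v \<in> W'"
  using assms
\<comment> \<open>For a subalgebra \<open>G\<close> of \<open>H\<close> maximal with a nonzero invariant in \<open>W/W'\<close>, the induction
  hypothesis for \<open>G\<close> acting on \<open>H/G\<close> yields \<open>x\<close> normalizing \<open>G\<close>. Only the action on \<open>W/W'\<close> is
  assumed nilpotent, so \<open>G\<close> must contain its kernel \<open>K\<close> to make \<open>H/G\<close> nilpotent as well.\<close>
proof (induction "dim H" arbitrary: H W W' rule: less_induct)
  case less
  note H = less.prems(1) and W = less.prems(2) and W' = less.prems(3) and WW = less.prems(4)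
  define K where "K = {h \<in> H. \<forall>w\<in>W. br h w \<in> W'}"
  have K: "subalgebra sc br K"
    unfolding subalgebra_def
  proof (intro conjI ballI)
    show "subspace K"
      using subalgebra_subspace[OF H] W'
      by (auto simp: K_def subspace_def br_add_left br_scale_left)
    fix x y assume "x \<in> K" "y \<in> K"
    then show "br x y \<in> K"
      using subalgebra_br[OF H] subspace_diff[OF W'] less.prems(5)
        less.prems(6) WW by (simp add: K_def br_br_left)
  qed
  define good where "good G \<longleftrightarrow> subalgebra sc br G \<and> K \<subseteq> G \<and> G \<subseteq> H \<and>
    (\<exists>v\<in>W - W'. \<forall>h\<in>G. br h v \<in> W')" for G
  \<comment> \<open>\<open>K\<close> acts as zero on the nonzero quotient \<open>W/W'\<close>, so
    any vector of \<open>W - W'\<close> serves.\<close>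
  have "good K"
    using K WW unfolding good_def K_def by blast
  moreover have "dim G < Suc (dim H)" if "good G" for G
    using that dim_subset[of G H] by (auto simp: good_def)
  ultimately obtain G where G: "good G" and max: "\<And>G'. good G' \<Longrightarrow> dim G' \<le> dim G"
    using ex_has_greatest_nat[of good K dim "Suc (dim H)"] by (metis less_imp_le)
  show ?case
  proof (cases "G = H")
    case True
    then show ?thesis using G by (auto simp: good_def)
  next
    case False
    have Gs: "subalgebra sc br G" "K \<subseteq> G" "G \<subset> H"
      using G False by (auto simp: good_def)
    have spG: "span G = G" and spH: "span H = H"
      using Gs(1) H by (auto simp: subalgebra_def)
    have lt: "dim G < dim H"
      using dim_psubset[of G H] Gs(3) by (simp add: spG spH)
    have nil: "\<exists>k. \<forall>u\<in>H. (br g ^^ k) u \<in> G" if g: "g \<in> G" for g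
    proof -
      have gH: "g \<in> H" using g Gs(3) by blast
      obtain k where k: "\<forall>w\<in>W. (br g ^^ k) w \<in> W'"
        using less.prems(7)[OF gH] by blast
      \<comment> \<open>\<open>(ad g)^k\<close> is zero on \<open>W/W'\<close>. Expanding the
        iterated commutator \<open>(ad g)^(2k) u\<close> as an operator leaves at least
        \<open>k\<close> factors \<open>ad g\<close> on one side of \<open>u\<close>, so it acts as
        zero as well.\<close>
      have "(br g ^^ (2 * k)) u \<in> K" if u: "u \<in> H" for u
      proof -
        have "br ((br g ^^ (2 * k)) u) w \<in> W'" if "w \<in> W" for w
          using ad_nilpotent_on_operators[OF W' psubset_imp_subset[OF WW] H less.prems(5,6) gH _ u that,
              of k 0 0 "2 * k"] k by simp
        moreover have "(br g ^^ (2 * k)) u \<in> H"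
          using ad_funpow_mem[of H g] H gH u by (simp add: subalgebra_def)
        ultimately show ?thesis by (simp add: K_def)
      qed
      then show ?thesis using Gs(2) by blast
    qed
    have "\<exists>x\<in>H - G. \<forall>g\<in>G. br g x \<in> G"
    proof (rule less.hyps[OF lt Gs(1) subalgebra_subspace[OF H] subalgebra_subspace[OF Gs(1)] Gs(3)])
      show "br h w \<in> H" if "h \<in> G" "w \<in> H" for h w
        using that Gs(3) subalgebra_br[OF H] by blast
      show "br h w \<in> G" if "h \<in> G" "w \<in> G" for h w
        using that subalgebra_br[OF Gs(1)] by blast
    qed (rule nil)
    then obtain x where x: "x \<in> H" "x \<notin> G" "\<And>g. g \<in> G \<Longrightarrow> br g x \<in> G" by blast
    \<comment> \<open>The preimage in \<open>W\<close> of the \<open>G\<close>-invariants of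
      \<open>W/W'\<close>. It is stable under \<open>ad x\<close> because \<open>x\<close>
      normalizes \<open>G\<close>.\<close>
    define V where "V = {v \<in> W. \<forall>g\<in>G. br g v \<in> W'}"
    have xV: "br x v \<in> V" if v: "v \<in> V" for v
    proof -
      have "br g (br x v) \<in> W'" if g: "g \<in> G" for g
      proof -
        have "br g (br x v) = br (br g x) v + br x (br g v)"
          using br_br_left[of g x v] by (simp add: algebra_simps)
        moreover have "br (br g x) v \<in> W'" "br x (br g v) \<in> W'"
          using v x g less.prems(6) by (auto simp: V_def)
        ultimately show ?thesis using W' by (simp add: subspace_add)
      qed
      then show ?thesis using v x(1) less.prems(5) by (simp add: V_def)
    qed
    obtain v0 where v0: "v0 \<in> V" "v0 \<notin> W'"
      using G by (auto simp: good_def V_def)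
    obtain k where k: "\<forall>w\<in>W. (br x ^^ k) w \<in> W'"
      using less.prems(7)[OF x(1)] by blast
    \<comment> \<open>The last iterate of \<open>v0\<close> outside \<open>W'\<close> is killed
      modulo \<open>W'\<close> by \<open>x\<close> and, being in \<open>V\<close>, also by
      \<open>G\<close>. This makes \<open>G + Fx\<close> good, against the maximality of
      \<open>G\<close>.\<close>
    define m where "m = (LEAST m. (br x ^^ m) v0 \<in> W')"
    have m: "(br x ^^ m) v0 \<in> W'"
      unfolding m_def by (rule LeastI[of _ k]) (use k v0 in \<open>auto simp: V_def\<close>)
    then obtain m' where m': "m = Suc m'" using v0(2) by (cases m) auto
    define v where "v = (br x ^^ m') v0"
    have v: "v \<in> V" "v \<notin> W'" "br x v \<in> W'"
      using ad_funpow_mem[of V x] xV v0(1) m m' not_less_Least[of m' "\<lambda>m. (br x ^^ m) v0 \<in> W'"]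
      by (auto simp: v_def m_def[symmetric])
    let ?G = "span (insert x G)"
    have "good ?G"
      unfolding good_def
    proof (intro conjI bexI[of _ v] ballI)
      show "subalgebra sc br ?G"
        using x(3) adjoin_superset by (intro subalgebra_adjoin[OF Gs(1)]) blast
      show "K \<subseteq> ?G" using Gs(2) adjoin_superset by blast
      show "?G \<subseteq> H"
        using x(1) Gs(3) subalgebra_subspace[OF H] by (intro span_minimal) auto
      show "v \<in> W - W'" using v by (auto simp: V_def)
      fix h assume "h \<in> ?G"
      then obtain c where c: "h - sc c x \<in> G"
        using mem_adjoin[OF subalgebra_subspace[OF Gs(1)]] by blast
      have "br h v = br (h - sc c x) v + sc c (br x v)" by (simp add: br_simps)
      then show "br h v \<in> W'"
        using c v W' by (simp add: V_def subspace_add subspace_scale)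
    qed
    then have "dim ?G \<le> dim G" by (rule max)
    moreover have "dim G < dim ?G"
      using x(2) adjoin_superset[of x G] by (intro dim_psubset) (auto simp: spG span_span)
    ultimately show ?thesis by simp
  qed
qed

end

section \<open>Modular and semi-modular subalgebras\<close>

context lie_alg
begin

lemma gen_sub_commute: "gen_sub sc br X Y = gen_sub sc br Y X"
  by (simp add: gen_sub_def Un_commute)

lemma gen_sub_absorb: "subalgebra sc br S \<Longrightarrow> X \<subseteq> S \<Longrightarrow> gen_sub sc br X S = S"
  using gen_sub_superset[of X S] gen_sub_least[of S X S] by blast

lemma coversD:
  assumes "covers sc br B A"
  shows "subalgebra sc br A" "subalgebra sc br B" "A \<subset> B"
    "subalgebra sc br C \<Longrightarrow> A \<subseteq> C \<Longrightarrow> C \<subseteq> B \<Longrightarrow> C = A \<or> C = B"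
  using assms by (auto simp: covers_def)

lemma modularD1:
  "modular sc br U \<Longrightarrow> subalgebra sc br B \<Longrightarrow> subalgebra sc br C \<Longrightarrow> B \<subseteq> C
    \<Longrightarrow> gen_sub sc br U B \<inter> C = gen_sub sc br B (U \<inter> C)"
  by (simp add: modular_def)

lemma modularD2:
  "modular sc br U \<Longrightarrow> subalgebra sc br B \<Longrightarrow> subalgebra sc br C \<Longrightarrow> U \<subseteq> C
    \<Longrightarrow> gen_sub sc br U B \<inter> C = gen_sub sc br (B \<inter> C) U"
  by (simp add: modular_def)

text \<open>The second modular law recovers each \<open>C\<close> between \<open>U\<close> and
  \<open>?M\<close> from \<open>B \<inter> C\<close>, which lies between \<open>U \<inter> B\<close>
  and \<open>B\<close> and so is one of these.\<close>

lemma modular_imp_upper_modular: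
  assumes U: "subalgebra sc br U" and mod: "modular sc br U"
  shows "upper_modular sc br U"
  unfolding upper_modular_def
proof (intro allI impI, elim conjE)
  fix B assume B: "subalgebra sc br B" and cov: "covers sc br B (U \<inter> B)"
  let ?M = "gen_sub sc br U B"
  show "covers sc br ?M U"
    unfolding covers_def
  proof (intro conjI allI impI; (elim conjE)?)
    show "subalgebra sc br U" by (rule U)
    show "subalgebra sc br ?M" by (rule subalgebra_gen_sub)
    show "U \<subset> ?M" using coversD(3)[OF cov] gen_sub_superset[of U B] by blast
    fix C assume C: "subalgebra sc br C" "U \<subseteq> C" "C \<subseteq> ?M"
    have eq: "?M \<inter> C = gen_sub sc br (B \<inter> C) U"
      by (rule modularD2[OF mod B C(1,2)])
    consider "B \<inter> C = U \<inter> B" | "B \<inter> C = B"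
      using coversD(4)[OF cov subalgebra_Int[OF B C(1)]] C(2) by blast
    then show "C = U \<or> C = ?M"
    proof cases
      case 1
      then have "?M \<inter> C = U"
        using gen_sub_absorb[OF U, of "U \<inter> B"] by (simp only: eq Int_lower1)
      then show ?thesis using C(3) by blast
    next
      case 2
      have "?M \<inter> C = ?M"
        unfolding eq 2 by (rule gen_sub_commute)
      then show ?thesis using C(3) by blast
    qed
  qed
qed

text \<open>Dually, the first modular law recovers each \<open>D\<close> between
  \<open>U \<inter> B\<close> and \<open>B\<close> as the trace on \<open>B\<close> of the
  subalgebra generated by \<open>U\<close> and \<open>D\<close>, for which the covering leaves two
  choices.\<close>

lemma modular_imp_lower_modular:
  assumes U: "subalgebra sc br U" and mod: "modular sc br U"
  shows "lower_modular sc br U"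
  unfolding lower_modular_def
proof (intro allI impI, elim conjE)
  fix B assume B: "subalgebra sc br B" and cov: "covers sc br (gen_sub sc br U B) U"
  let ?M = "gen_sub sc br U B"
  show "covers sc br B (U \<inter> B)"
    unfolding covers_def
  proof (intro conjI allI impI; (elim conjE)?)
    show UB: "subalgebra sc br (U \<inter> B)" by (rule subalgebra_Int[OF U B])
    show "subalgebra sc br B" by (rule B)
    show "U \<inter> B \<subset> B"
      using coversD(3)[OF cov] gen_sub_least[OF U, of U B] by blast
    fix D assume D: "subalgebra sc br D" "U \<inter> B \<subseteq> D" "D \<subseteq> B"
    have "gen_sub sc br U D \<inter> B = gen_sub sc br D (U \<inter> B)"
      by (rule modularD1[OF mod D(1) B D(3)])
    then have eq: "D = gen_sub sc br U D \<inter> B"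
      using gen_sub_absorb[OF D(1,2)] gen_sub_commute[of D "U \<inter> B"] by simp
    have "gen_sub sc br U D = U \<or> gen_sub sc br U D = ?M"
      using D(3) gen_sub_superset[of U D]
      by (intro coversD(4)[OF cov subalgebra_gen_sub] gen_sub_mono) auto
    then show "D = U \<inter> B \<or> D = B"
      using eq gen_sub_superset[of U B] by blast
  qed
qed

section \<open>Quasi-ideals\<close>

lemma quasi_ideal_br:
  assumes "quasi_ideal sc br U" "subspace V" "u \<in> U" "v \<in> V"
  shows "\<exists>q\<in>U. \<exists>w\<in>V. br u v = q + w"
proof -
  have "br u v \<in> span {br q v |q v. q \<in> U \<and> v \<in> V}"
    using assms(3,4) by (intro span_base) blast
  then show ?thesis using assms(1,2) unfolding quasi_ideal_def by blast
qed

text \<open>Taking \<open>V = B\<close> in the definition of a quasi-ideal puts the mixed brackets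
  into \<open>U + B\<close>, which is therefore closed.\<close>

lemma gen_sub_quasi_ideal:
  assumes Q: "quasi_ideal sc br U" and B: "subalgebra sc br B"
  shows "gen_sub sc br U B = {u + b |u b. u \<in> U \<and> b \<in> B}" (is "_ = ?S")
proof
  have U: "subalgebra sc br U" using Q by (simp add: quasi_ideal_def)
  note sU = subalgebra_subspace[OF U] and sB = subalgebra_subspace[OF B]
  have S: "subspace ?S" by (rule subspace_sums[OF sU sB])
  have US: "U \<subseteq> ?S" and BS: "B \<subseteq> ?S"
    using subspace_0[OF sU] subspace_0[OF sB] by force+
  have UB: "br u b \<in> ?S" if "u \<in> U" "b \<in> B" for u b
    using quasi_ideal_br[OF Q sB that] by blast
  have "subalgebra sc br ?S"
    unfolding subalgebra_def
  proof (intro conjI ballI S)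
    fix x y assume "x \<in> ?S" "y \<in> ?S"
    then obtain u b u' b' where *: "x = u + b" "y = u' + b'" "u \<in> U" "u' \<in> U" "b \<in> B" "b' \<in> B"
      by blast
    have "br x y = (br u u' + br u b') + (br b b' - br u' b)"
      using br_swap[of b u'] by (simp add: * br_simps)
    moreover have "br u u' \<in> ?S" "br b b' \<in> ?S"
      using * US BS subalgebra_br[OF U] subalgebra_br[OF B] by blast+
    ultimately show "br x y \<in> ?S"
      using UB * by (simp only:) (intro subspace_add[OF S] subspace_diff[OF S])
  qed
  then show "gen_sub sc br U B \<subseteq> ?S" using US BS by (rule gen_sub_least)
  show "?S \<subseteq> gen_sub sc br U B"
    using gen_sub_superset[of U B] subspace_add[OF subalgebra_subspace[OF subalgebra_gen_sub]]
    by blast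
qed

text \<open>Joins with \<open>U\<close> are sums of subspaces, so both laws reduce to the modular
  law for subspaces: in \<open>x = u + b\<close> the summand from the subalgebra inside
  \<open>C\<close> is subtracted, and the other one then lies in \<open>C\<close>.\<close>

lemma quasi_ideal_imp_modular:
  assumes Q: "quasi_ideal sc br U"
  shows "modular sc br U"
  unfolding modular_def
proof (intro conjI allI impI; elim conjE)
  have U: "subalgebra sc br U" using Q by (simp add: quasi_ideal_def)
  fix B C assume B: "subalgebra sc br B" and C: "subalgebra sc br C"
  note sC = subalgebra_subspace[OF C]
  have mem: "u + b \<in> gen_sub sc br X Y" if "u \<in> X \<union> Y" "b \<in> X \<union> Y" for u b X Y
    using that gen_sub_superset[of X Y] subspace_add[OF subalgebra_subspace[OF subalgebra_gen_sub]]
    by blast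
  show "gen_sub sc br U B \<inter> C = gen_sub sc br B (U \<inter> C)" if BC: "B \<subseteq> C"
  proof
    show "gen_sub sc br B (U \<inter> C) \<subseteq> gen_sub sc br U B \<inter> C"
      using gen_sub_least[OF C BC, of "U \<inter> C"] gen_sub_mono[of B B "U \<inter> C" U]
      unfolding gen_sub_commute[of U B] by blast
    show "gen_sub sc br U B \<inter> C \<subseteq> gen_sub sc br B (U \<inter> C)"
    proof
      fix x assume x: "x \<in> gen_sub sc br U B \<inter> C"
      then obtain u b where *: "x = u + b" "u \<in> U" "b \<in> B"
        unfolding gen_sub_quasi_ideal[OF Q B] by blast
      have "x - b \<in> C" using x BC *(3) subspace_diff[OF sC] by blast
      then show "x \<in> gen_sub sc br B (U \<inter> C)"
        using mem[of u B "U \<inter> C" b] * by simp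
    qed
  qed
  show "gen_sub sc br U B \<inter> C = gen_sub sc br (B \<inter> C) U" if UC: "U \<subseteq> C"
  proof
    show "gen_sub sc br (B \<inter> C) U \<subseteq> gen_sub sc br U B \<inter> C"
      using gen_sub_least[OF C _ UC, of "B \<inter> C"] gen_sub_mono[of "B \<inter> C" B U U]
      unfolding gen_sub_commute[of U B] by blast
    show "gen_sub sc br U B \<inter> C \<subseteq> gen_sub sc br (B \<inter> C) U"
    proof
      fix x assume x: "x \<in> gen_sub sc br U B \<inter> C"
      then obtain u b where *: "x = u + b" "u \<in> U" "b \<in> B"
        unfolding gen_sub_quasi_ideal[OF Q B] by blast
      have "x - u \<in> C" using x UC *(2) subspace_diff[OF sC] by blast
      then show "x \<in> gen_sub sc br (B \<inter> C) U"
        using mem[of u "B \<inter> C" U b] * by simp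
    qed
  qed
qed

text \<open>The condition can be tested on single vectors, since \<open>[u, v]\<close> in
  \<open>U + Fv\<close> lies in \<open>U + V\<close> for every subspace \<open>V\<close> containing
  \<open>v\<close>.\<close>

lemma quasi_idealI:
  assumes U: "subalgebra sc br U"
    and adj: "\<And>x u. x \<notin> U \<Longrightarrow> u \<in> U \<Longrightarrow> br u x \<in> span (insert x U)"
  shows "quasi_ideal sc br U"
  unfolding quasi_ideal_def
proof (intro conjI U allI impI)
  fix V assume V: "subspace V"
  note sU = subalgebra_subspace[OF U]
  show "span {br q v |q v. q \<in> U \<and> v \<in> V} \<subseteq> {q + v |q v. q \<in> U \<and> v \<in> V}" (is "_ \<subseteq> ?S")
  proof (rule span_minimal)
    show "subspace ?S" by (rule subspace_sums[OF sU V])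
    show "{br q v |q v. q \<in> U \<and> v \<in> V} \<subseteq> ?S"
    proof clarify
      fix u v assume u: "u \<in> U" and v: "v \<in> V"
      have "\<exists>k. br u v - sc k v \<in> U"
      proof (cases "v \<in> U")
        case True
        then show ?thesis using subalgebra_br[OF U u] by (intro exI[of _ 0]) simp
      next
        case False
        then show ?thesis using adj u mem_adjoin[OF sU] by blast
      qed
      then obtain k where "br u v - sc k v \<in> U" by blast
      then show "\<exists>q w. br u v = q + w \<and> q \<in> U \<and> w \<in> V"
        using subspace_scale[OF V v]
        by (intro exI[of _ "br u v - sc k v"] exI[of _ "sc k v"]) simp
    qed
  qed
qed

text \<open>Diagonalizability of \<open>ad s\<close>, stated on each invariant subspace so that it
  can be used directly on the subalgebras that \<open>ad s\<close> preserves;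
  \<open>W = UNIV\<close> is the usual notion.\<close>

definition diagonalizable_on_invariant :: "'v \<Rightarrow> bool" where
  "diagonalizable_on_invariant s \<longleftrightarrow>
    (\<forall>W. subspace W \<longrightarrow> br s ` W \<subseteq> W \<longrightarrow> W \<subseteq> span {w \<in> W. \<exists>c. br s w = sc c w})"

text \<open>The line through \<open>s\<close> meets \<open>U\<close> in \<open>0\<close> and covers
  it, so upper modularity applies.\<close>

lemma upper_modular_covers_line:
  assumes U: "subalgebra sc br U" and um: "upper_modular sc br U" and s: "s \<notin> U"
  shows "covers sc br (gen_sub sc br U (span {s})) U"
proof -
  note sU = subalgebra_subspace[OF U]
  have "U \<inter> span {s} = {0}"
  proof -
    have "sc k s = 0" if "sc k s \<in> U" for k
      using that s subspace_scale[OF sU that, of "inverse k"] by (cases "k = 0") auto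
    then show ?thesis using subspace_0[OF sU] by (auto simp: span_singleton span_zero)
  qed
  moreover have "covers sc br (span {s}) {0}"
    unfolding covers_def
  proof (intro conjI allI impI; (elim conjE)?)
    show "subalgebra sc br {0}" by (simp add: subalgebra_def subspace_def)
    show "subalgebra sc br (span {s})" by (rule subalgebra_line)
    have "s \<noteq> 0" using s subspace_0[OF sU] by auto
    then show "{0} \<subset> span {s}" using span_base[of s "{s}"] span_zero by blast
    fix C assume C: "subalgebra sc br C" "{0} \<subseteq> C" "C \<subseteq> span {s}"
    show "C = {0} \<or> C = span {s}"
    proof (cases "C = {0}")
      case False
      then obtain y where y: "y \<in> C" "y \<noteq> 0" using C(2) by blast
      then obtain k where k: "sc k s \<in> C" "sc k s \<noteq> 0"
        using C(3) by (auto simp: span_singleton)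
      then have "s \<in> C"
        using subspace_scale[OF subalgebra_subspace[OF C(1)] k(1), of "inverse k"] by auto
      then show ?thesis
        using C span_minimal[of "{s}" C] subalgebra_subspace by auto
    qed simp
  qed
  ultimately show ?thesis
    using um subalgebra_line by (simp add: upper_modular_def)
qed

text \<open>\<open>?M\<close> is stable under \<open>ad s\<close>, hence spanned by eigenvectors of
  \<open>ad s\<close>. Each eigenvector spans a subalgebra together with \<open>s\<close>, and lower
  modularity transfers the covering of \<open>U\<close> by \<open>?M\<close> to it.\<close>

lemma gen_sub_diagonalizable:
  assumes U: "subalgebra sc br U" and um: "upper_modular sc br U" and lm: "lower_modular sc br U"
    and s: "s \<notin> U" "diagonalizable_on_invariant s"
  shows "gen_sub sc br U (span {s}) = span (insert s U)" (is "?M = ?A")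
proof
  note sU = subalgebra_subspace[OF U]
  note cov = upper_modular_covers_line[OF U um s(1)]
  note M = subalgebra_gen_sub[of U "span {s}"]
  have sM: "s \<in> ?M" and UM: "U \<subseteq> ?M"
    using gen_sub_superset[of U "span {s}"] span_base[of s "{s}"] by blast+
  show "?A \<subseteq> ?M"
    using sM UM subalgebra_subspace[OF M] by (intro span_minimal) auto
  \<comment> \<open>Otherwise the plane \<open>?B\<close> spanned by \<open>s\<close> and \<open>w\<close> meets \<open>U\<close> in \<open>0\<close>, which it does not cover.\<close>
  have eig: "w \<in> ?A" if w: "w \<in> ?M" "br s w = sc c w" for w c
  proof (rule ccontr)
    assume wA: "w \<notin> ?A"
    let ?B = "span (insert w (span {s}))"
    have memB: "y \<in> ?B \<longleftrightarrow> (\<exists>k j. y = sc k w + sc j s)" for y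
    proof -
      have "y \<in> ?B \<longleftrightarrow> (\<exists>k j. y - sc k w = sc j s)"
        unfolding mem_adjoin[OF subspace_span] by (auto simp: span_singleton)
      then show ?thesis by (simp add: diff_eq_eq add.commute)
    qed
    have B: "subalgebra sc br ?B"
    proof (rule subalgebra_adjoin[OF subalgebra_line])
      fix u assume "u \<in> span {s}"
      then obtain k where "u = sc k s" by (auto simp: span_singleton)
      then have "br u w = sc (k * c) w" using w(2) by (simp add: br_scale_left)
      then show "br u w \<in> ?B" by (simp add: span_base span_scale)
    qed
    have "gen_sub sc br U ?B = ?M"
    proof
      have "span {s} \<subseteq> ?M"
        using sM subalgebra_subspace[OF M] by (intro span_minimal) auto
      then have "?B \<subseteq> ?M"
        using w(1) subalgebra_subspace[OF M] by (intro span_minimal) auto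
      then show "gen_sub sc br U ?B \<subseteq> ?M" using UM by (intro gen_sub_least[OF M])
      show "?M \<subseteq> gen_sub sc br U ?B"
        using span_superset[of "insert w (span {s})"] by (intro gen_sub_mono) auto
    qed
    then have covB: "covers sc br ?B (U \<inter> ?B)"
      using lm B cov by (simp add: lower_modular_def)
    have "U \<inter> ?B \<subseteq> span {s}"
    proof
      fix y assume y: "y \<in> U \<inter> ?B"
      then obtain k j where kj: "y = sc k w + sc j s" using memB by blast
      have "k = 0"
      proof (rule ccontr)
        assume "k \<noteq> 0"
        then have "w - sc (- j / k) s = sc (1 / k) y"
          by (simp add: kj scale_right_distrib)
        moreover have "sc (1 / k) y \<in> U" using y subspace_scale[OF sU] by blast
        ultimately have "w \<in> ?A" unfolding mem_adjoin[OF sU] by metis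
        then show False using wA by simp
      qed
      then show "y \<in> span {s}" using kj by (simp add: span_base span_scale)
    qed
    \<comment> \<open>The line \<open>Fs\<close> lies between \<open>U \<inter> ?B\<close> and
      \<open>?B\<close>, but \<open>s\<close> separates it from the former and \<open>w\<close> from
      the latter.\<close>
    then have "span {s} = U \<inter> ?B \<or> span {s} = ?B"
      using span_superset[of "insert w (span {s})"] coversD(4)[OF covB subalgebra_line[of s]] by blast
    moreover have "s \<notin> U \<inter> ?B" "s \<in> span {s}" using s(1) by (auto simp: span_base)
    moreover have "span {s} \<subseteq> ?A" by (rule span_mono) simp
    then have "w \<notin> span {s}" using wA by blast
    moreover have "w \<in> ?B" by (simp add: span_base)
    ultimately show False by metis
  qed
  have "br s ` ?M \<subseteq> ?M" using subalgebra_br[OF M sM] by blast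
  then have "?M \<subseteq> span {w \<in> ?M. \<exists>c. br s w = sc c w}"
    using s(2) subalgebra_subspace[OF M] by (simp add: diagonalizable_on_invariant_def)
  also have "\<dots> \<subseteq> ?A" using eig by (intro span_minimal) auto
  finally show "?M \<subseteq> ?A" .
qed

end

section \<open>The \<open>p\<close>-map and the passage from semi-modular to quasi-ideal\<close>

locale fd_pmap_lie_alg = fd_lie_alg sc br Basis
  for sc :: "'f::field \<Rightarrow> 'v::ab_group_add \<Rightarrow> 'v" and br and Basis +
  fixes pm :: "'v \<Rightarrow> 'v"
  assumes alg_closed: "alg_closed_field TYPE('f)"
    and prime_char: "prime CHAR('f)"
    and ad_pm: "br (pm x) y = (br x ^^ CHAR('f)) y"
begin

lemma ad_pm_funpow: "br ((pm ^^ n) x) = br x ^^ (CHAR('f) ^ n)"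
proof (induction n)
  case (Suc n)
  have "br ((pm ^^ Suc n) x) = br ((pm ^^ n) x) ^^ CHAR('f)"
    by (rule ext) (simp add: ad_pm)
  then show ?case by (simp add: Suc funpow_mult mult.commute)
qed simp

lemma ex_diagonalizable_pm_funpow: "\<exists>n. diagonalizable_on_invariant ((pm ^^ n) x)"
proof -
  obtain n where "\<forall>W v. subspace W \<longrightarrow> (br x ^^ (CHAR('f) ^ n)) ` W \<subseteq> W \<longrightarrow> v \<in> W \<longrightarrow>
      v \<in> span {w \<in> W. \<exists>c. (br x ^^ (CHAR('f) ^ n)) w = sc c w}"
    using frobenius_power_diagonalizable[OF alg_closed prime_char, of "br x"]
      br_add_right br_scale_right by blast
  then have "diagonalizable_on_invariant ((pm ^^ n) x)"
    unfolding diagonalizable_on_invariant_def ad_pm_funpow by blast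
  then show ?thesis ..
qed

lemma semi_modular_adjoin:
  assumes U: "subalgebra sc br U" and um: "upper_modular sc br U" and lm: "lower_modular sc br U"
    and x: "x \<notin> U" and u0: "u0 \<in> U"
  shows "br u0 x \<in> span (insert x U)"
proof (rule ccontr)
  assume contra: "br u0 x \<notin> span (insert x U)"
  note sU = subalgebra_subspace[OF U]
  define M where "M = gen_sub sc br U (span {x})"
  have cov: "covers sc br M U"
    unfolding M_def by (rule upper_modular_covers_line[OF U um x])
  note M = coversD(2)[OF cov]
  note sM = subalgebra_subspace[OF M]
  have UM: "U \<subset> M" by (rule coversD(3)[OF cov])
  have xM: "x \<in> M"
    using gen_sub_superset[of U "span {x}"] span_base[of x "{x}"] unfolding M_def by blast
  \<comment> \<open>Such an \<open>s\<close> makes \<open>U + Fs\<close> a subalgebra, equal to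
    \<open>M\<close> by the covering. Then \<open>M = U + Fx\<close>, which contains
    \<open>[u0, x]\<close>.\<close>
  have no_codim_1: False
    if s: "s \<in> M" "s \<notin> U" and br: "\<And>u. u \<in> U \<Longrightarrow> br u s \<in> span (insert s U)" for s
  proof -
    let ?A = "span (insert s U)"
    have "?A \<subseteq> M" using s(1) UM sM by (intro span_minimal) auto
    then have "?A = M"
      using coversD(4)[OF cov subalgebra_adjoin[OF U br]] adjoin_superset[of s U] s(2) by blast
    then obtain k where k: "x - sc k s \<in> U" using xM mem_adjoin[OF sU] by blast
    then have "k \<noteq> 0" using x by auto
    then have "s - sc (1 / k) x = sc (- 1 / k) (x - sc k s)"
      by (simp add: scale_right_diff_distrib)
    moreover have "sc (- 1 / k) (x - sc k s) \<in> U" using k by (rule subspace_scale[OF sU])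
    ultimately have "s \<in> span (insert x U)" unfolding mem_adjoin[OF sU] by metis
    then have "?A \<subseteq> span (insert x U)"
      using span_superset[of "insert x U"] by (intro span_minimal) auto
    moreover have "br u0 x \<in> M" using u0 UM xM subalgebra_br[OF M] by blast
    ultimately show False using contra \<open>?A = M\<close> by blast
  qed
  have self_normalizing: "v \<in> U" if v: "v \<in> M" "\<And>u. u \<in> U \<Longrightarrow> br v u \<in> U" for v
  proof (rule ccontr)
    assume "v \<notin> U"
    moreover have "br u v \<in> span (insert v U)" if "u \<in> U" for u
    proof -
      have "br u v \<in> U" using v(2)[OF that] br_swap[of u v] subspace_neg[OF sU] by simp
      then show ?thesis by (simp add: span_base)
    qed
    ultimately show False using no_codim_1 v(1) by blast
  qed
  \<comment> \<open>For \<open>s\<close> outside \<open>U\<close>, \<open>[s, u]\<close> lies in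
    \<open>U + Fs\<close>. As \<open>s\<close> is not in \<open>M\<close>, this space meets
    \<open>M\<close> in \<open>U\<close> only. Here \<open>y\<close> is only asked to normalize
    \<open>M\<close>, since it is later a sum \<open>s + e\<close> whose first term may lie outside
    \<open>M\<close>.\<close>
  have normalizes: "br s u \<in> U"
    if y: "\<And>m. m \<in> M \<Longrightarrow> br y m \<in> M" and s: "s = (pm ^^ n) y" "diagonalizable_on_invariant s"
      and u: "u \<in> U" for y n s u
  proof (cases "s \<in> U")
    case True
    then show ?thesis using subalgebra_br[OF U _ u] by simp
  next
    case False
    have br: "br u s \<in> span (insert s U)" if "u \<in> U" for u
      using subalgebra_br[OF subalgebra_gen_sub, of u U "span {s}" s] that
        gen_sub_superset[of U "span {s}"] span_base[of s "{s}"]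
      unfolding gen_sub_diagonalizable[OF U um lm False s(2)] by blast
    then have sM': "s \<notin> M" using no_codim_1 False by blast
    have "br s u \<in> span (insert s U)"
      using span_neg[OF br[OF u]] br_swap[of s u] by simp
    then obtain k where k: "br s u - sc k s \<in> U" using mem_adjoin[OF sU] by blast
    have "br s u \<in> M"
      using u UM ad_funpow_mem[of M y, OF y] by (auto simp: s(1) ad_pm_funpow)
    then have "sc k s \<in> M"
      using k UM subspace_diff[OF sM, of "br s u" "br s u - sc k s"] by auto
    then have "k = 0"
      using sM' subspace_scale[OF sM, of "sc k s" "inverse k"] by (cases "k = 0") auto
    then show ?thesis using k by simp
  qed
  \<comment> \<open>For a diagonalizable \<open>p\<close>-power \<open>s\<close> of
    \<open>u\<close>, all eigenvectors in \<open>M\<close> with nonzero eigenvalue lie in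
    \<open>U\<close>. So \<open>ad s\<close>, a power of \<open>ad u\<close>, maps \<open>M\<close>
    into \<open>U\<close>.\<close>
  have nil: "\<exists>k. \<forall>w\<in>M. (br u ^^ k) w \<in> U" if u: "u \<in> U" for u
  proof -
    obtain n where n: "diagonalizable_on_invariant ((pm ^^ n) u)"
      using ex_diagonalizable_pm_funpow by blast
    define s where "s = (pm ^^ n) u"
    have ads: "br s = br u ^^ (CHAR('f) ^ n)" unfolding s_def by (rule ad_pm_funpow)
    have sU': "br s v \<in> U" if "v \<in> U" for v
      using that u ad_funpow_mem[of U u] subalgebra_br[OF U] by (simp add: ads)
    have sM': "br s v \<in> M" if "v \<in> M" for v
      using that u UM ad_funpow_mem[of M u] subalgebra_br[OF M] by (auto simp: ads)
    have eig: "e \<in> U" if e: "e \<in> M" "br s e = sc c e" "c \<noteq> 0" for e c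
    proof -
      \<comment> \<open>A diagonalizable \<open>p\<close>-power \<open>t\<close> of \<open>s + e\<close> normalizes \<open>U\<close>, and so does \<open>[s, t]\<close>, which is a
        nonzero multiple of \<open>e\<close>.\<close>
      define y where "y = s + e"
      obtain n' where n': "diagonalizable_on_invariant ((pm ^^ n') y)"
        using ex_diagonalizable_pm_funpow by blast
      define t where "t = (pm ^^ n') y"
      define q where "q = CHAR('f) ^ n'"
      have yM: "br y m \<in> M" if "m \<in> M" for m
        using that sM' subalgebra_br[OF M e(1)] subspace_add[OF sM] by (simp add: y_def br_add_left)
      have tU: "br t v \<in> U" if "v \<in> U" for v
        using normalizes[OF yM t_def] n' that by (simp add: t_def)
      have "br y s = - sc c e"
        using br_swap[of e s] by (simp add: y_def br_simps e(2))
      have powe: "(br y ^^ k) e = sc (c ^ k) e" for k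
        by (induction k) (simp_all add: y_def br_simps e(2) mult.commute)
      have "q \<noteq> 0" using prime_char by (simp add: q_def prime_gt_0_nat)
      then obtain r where r: "q = Suc r" by (cases q) auto
      have neg: "(br y ^^ k) (- v) = - (br y ^^ k) v" for k v
        by (induction k) (simp_all add: br_minus_right)
      have sc: "(br y ^^ k) (sc a v) = sc a ((br y ^^ k) v)" for k a v
        by (induction k) (simp_all add: br_scale_right)
      \<comment> \<open>One factor of \<open>(ad y)^q\<close> is spent on
        \<open>[y, s] = - c e\<close>; the other \<open>r\<close> act on the eigenvector
        \<open>e\<close> of \<open>ad y\<close>.\<close>
      have "br t s = (br y ^^ r) (br y s)"
        unfolding t_def ad_pm_funpow q_def[symmetric] r by (simp add: funpow_swap1)
      also have "\<dots> = - sc (c ^ q) e"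
        by (simp add: \<open>br y s = - sc c e\<close> neg sc powe r)
      finally have st: "br s t = sc (c ^ q) e" using br_swap[of s t] by simp
      have "sc (c ^ q) e \<in> U"
      proof (rule self_normalizing)
        show "sc (c ^ q) e \<in> M" using e(1) by (rule subspace_scale[OF sM])
        fix v assume "v \<in> U"
        then show "br (sc (c ^ q) e) v \<in> U"
          unfolding st[symmetric] br_br_left by (intro subspace_diff[OF sU] sU' tU)
      qed
      then show "e \<in> U"
        using subspace_scale[OF sU, of "sc (c ^ q) e" "inverse (c ^ q)"] e(3) by simp
    qed
    have "br s ` M \<subseteq> M" using sM' by blast
    then have M_span: "M \<subseteq> span {w \<in> M. \<exists>c. br s w = sc c w}"
      using n sM unfolding s_def diagonalizable_on_invariant_def by blast
    have "span {w \<in> M. \<exists>c. br s w = sc c w} \<subseteq> {w. br s w \<in> U}"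
    proof (rule span_minimal)
      show "subspace {w. br s w \<in> U}"
        using sU by (simp add: subspace_def br_add_right br_scale_right)
      show "{w \<in> M. \<exists>c. br s w = sc c w} \<subseteq> {w. br s w \<in> U}"
      proof clarify
        fix w c assume w: "w \<in> M" "br s w = sc c w"
        show "br s w \<in> U"
          using eig[OF w] w(2) subspace_0[OF sU] subspace_scale[OF sU] by (cases "c = 0") auto
      qed
    qed
    then show ?thesis using M_span unfolding ads by blast
  qed
  have "\<exists>v\<in>M - U. \<forall>u\<in>U. br u v \<in> U"
  proof (rule engel[OF U sM sU UM])
    show "br h w \<in> M" if "h \<in> U" "w \<in> M" for h w
      using that UM subalgebra_br[OF M] by blast
    show "br h w \<in> U" if "h \<in> U" "w \<in> U" for h w
      using that by (rule subalgebra_br[OF U])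
  qed (rule nil)
  then obtain v where v: "v \<in> M" "v \<notin> U" "\<And>u. u \<in> U \<Longrightarrow> br u v \<in> U" by blast
  then have "br v u \<in> U" if "u \<in> U" for u
    using that br_swap[of v u] subspace_neg[OF sU] by simp
  then show False using self_normalizing v by blast
qed

end

theorem theorem2p7:
  fixes sc :: "'f::field \<Rightarrow> 'v::ab_group_add \<Rightarrow> 'v"
    and br :: "'v \<Rightarrow> 'v \<Rightarrow> 'v"
    and pm :: "'v \<Rightarrow> 'v"
    and p :: nat
    and U :: "'v set"
  assumes "alg_closed_field TYPE('f)"
    and "CHAR('f) = p" and "p > 0"
    and "restricted_lie_algebra sc br p pm"
    and "fin_dim sc"
    and "subalgebra sc br U" and "U \<noteq> UNIV"
  shows "(modular sc br U \<longleftrightarrow> semi_modular sc br U)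
       \<and> (semi_modular sc br U \<longleftrightarrow> quasi_ideal sc br U)"
proof -
  have lie: "lie_algebra sc br" and ad_pm: "\<And>x y. br (pm x) y = (br x ^^ p) y"
    using assms(4) unfolding restricted_lie_algebra_def by auto
  interpret vector_space sc using lie by (simp add: lie_algebra_def)
  interpret lie_alg sc br
    using lie by unfold_locales (auto simp: lie_algebra_def)
  \<comment> \<open>A finite spanning set is thinned to a basis, as the finite-dimensional locale
    requires.\<close>
  obtain S where S: "finite S" "span S = UNIV"
    using assms(5) by (auto simp: fin_dim_def)
  obtain B where B: "B \<subseteq> S" "independent B" "S \<subseteq> span B"
    using maximal_independent_subset by blast
  have "span B = UNIV"
    using S(2) span_minimal[OF B(3) subspace_span] by auto
  moreover have "finite B" using B(1) S(1) finite_subset by blast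
  \<comment> \<open>A field has no zero divisors, so its positive characteristic is prime.\<close>
  ultimately interpret fd_pmap_lie_alg sc br B pm
    using B(2) assms(1-3) ad_pm prime_CHAR_semidom[where ?'a = 'f]
    by unfold_locales auto
  \<comment> \<open>The cycle of implications runs from modular to semi-modular to quasi-ideal and
    back to modular.\<close>
  have "quasi_ideal sc br U" if "semi_modular sc br U"
    using that semi_modular_adjoin[OF assms(6)] by (intro quasi_idealI assms(6)) (auto simp: semi_modular_def)
  moreover have "semi_modular sc br U" if "modular sc br U"
    using that modular_imp_upper_modular modular_imp_lower_modular assms(6)
    by (simp add: semi_modular_def)
  ultimately show ?thesis using quasi_ideal_imp_modular by blast
qed

end
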